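(* Let $\Phi=B_1|\cdots|B_k$ be a set composition of $n$ and $\Psi$ a set composition. Then \[ P_\Phi P_\Psi = \sum_{\Gamma \in \Phi\sqcup\!\sqcup(\Psi \uparrow n)}P_\Gamma, \qquad \Delta(P_\Phi)=\sum_{i=0}^{k}P_{st(B_1|\cdots|B_i)}\otimes P_{st(B_{i+1}|\cdots|B_k)}. \]
   Context: A set composition $\Phi=B_1|\cdots|B_k$ of $n$ is a sequence of pairwise disjoint nonempty subsets of $[n]$ with $|B_1|+\dots+|B_k|=n$. For a word $a_1\cdots a_n$, $\varrho$ gives the set composition with $i$ in block number $|\{a_l:a_l<a_i\}|+1$; $\mathrm{NCQSym}$ has basis $M_\Phi=\sum_{\varrho(a)=\Phi}x_{a_1}\cdots x_{a_n}$ in noncommuting variables. Order sets by $A>_{\widetilde{\mathcal D}}B$ if $|A|>|B|$, or $|A|=|B|$ and $\min A<\min B$. A labelled diagonal descending (LDD) filling of $\Phi$ places $B_i$ in row $i$ of a matrix, $B_1$ in the first column, and $B_{i+1}$ may be in the same column as $B_i$ if $B_i>_{\widetilde{\mathcal D}}B_{i+1}$, otherwise it is in the next column to the right; $\mathsf{col}$ of a filling is the set composition of unions of the sets in each column. Define $P_\Phi=\sum_{\tilde{\mathsf F}\in\mathsf{LDD}(\Phi)}M_{\mathsf{col}(\tilde{\mathsf F})}$. For set compositions $\Phi=B_1|\cdots|B_k$ and $\Psi=A_1|\cdots|A_j$ with all blocks disjoint, the shuffle is defined recursively by $\emptyset\sqcup\!\sqcup\Phi=\Phi\sqcup\!\sqcup\emptyset=\Phi$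 and $\Phi\sqcup\!\sqcup\Psi=B_1|\big((B_2|\cdots|B_k)\sqcup\!\sqcup\Psi\big)+A_1|\big(\Phi\sqcup\!\sqcup(A_2|\cdots|A_j)\big)$. $\Psi\uparrow n$ adds $n$ to every element of every block of $\Psi$. The standardization $st(\Phi)$ of a sequence of disjoint sets with $m$ total elements is the set composition of $[m]$ obtained by replacing elements by $1,\dots,m$ preserving relative order. *)

theory Defs
  imports Complex_Main "HOL-Library.Multiset" "HOL-Library.Disjoint_Sets" "HOL-Library.Function_Algebras"
begin

section \<open>Set compositions\<close>

definition set_composition :: "nat \<Rightarrow> nat set list \<Rightarrow> bool" where
  "set_composition n \<Phi> \<longleftrightarrow>
     (\<forall>B \<in> set \<Phi>. B \<noteq> {} \<and> B \<subseteq> {1..n}) \<and>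
     disjoint_family_on (\<lambda>i. \<Phi> ! i) {..<length \<Phi>} \<and>
     (\<Sum>B\<leftarrow>\<Phi>. card B) = n"

definition shift :: "nat set list \<Rightarrow> nat \<Rightarrow> nat set list"  (infixl \<open>\<up>\<close> 80) where
  "\<Psi> \<up> n = map (\<lambda>B. (\<lambda>x. x + n) ` B) \<Psi>"

definition st :: "nat set list \<Rightarrow> nat set list" where
  "st \<Phi> = map (\<lambda>B. (\<lambda>x. card {y \<in> \<Union>(set \<Phi>). y \<le> x}) ` B) \<Phi>"

text \<open>The shuffle is a formal sum of words in the blocks, hence a multiset; the library
  constant \<^const>\<open>shuffles\<close> is its underlying set.\<close>

fun shuffle :: "'b list \<Rightarrow> 'b list \<Rightarrow> 'b list multiset" where
  "shuffle [] ys = {#ys#}"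
| "shuffle xs [] = {#xs#}"
| "shuffle (x # xs) (y # ys) =
     image_mset (\<lambda>zs. x # zs) (shuffle xs (y # ys)) + image_mset (\<lambda>zs. y # zs) (shuffle (x # xs) ys)"

section \<open>Series in noncommuting variables\<close>

text \<open>A formal series in noncommuting variables is given by its coefficients on words.
  The letters are natural numbers, so the alphabet is $x_0, x_1, x_2, \ldots$ (only the order type
  of the index set matters).  Addition is pointwise; multiplication is the concatenation product,
  and not the pointwise product of the library instance for functions.\<close>

type_synonym 'a ncseries = "nat list \<Rightarrow> 'a"

definition nc_mult :: "'a::comm_ring_1 ncseries \<Rightarrow> 'a ncseries \<Rightarrow> 'a ncseries"  (infixl \<open>\<odot>\<close> 70) where
  "f \<odot> g = (\<lambda>w. \<Sum>(u, v) \<in> {(u, v). u @ v = w}. f u * g v)"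

definition scale :: "'a::comm_ring_1 \<Rightarrow> ('w \<Rightarrow> 'a) \<Rightarrow> 'w \<Rightarrow> 'a" where
  "scale c f = (\<lambda>w. c * f w)"

text \<open>The tensor square of the space of series is realised inside the functions on pairs of words:
  $f \otimes g$ has the coefficient $f(u) g(v)$ at $(u,v)$.  On the tensor square of the free module
  spanned by the $M_\Phi$ this is faithful, because the $M_\Phi \otimes M_\Psi$ become indicator
  functions of disjoint nonempty sets.\<close>

definition tensor :: "'a::comm_ring_1 ncseries \<Rightarrow> 'a ncseries \<Rightarrow> nat list \<times> nat list \<Rightarrow> 'a"
    (infixl \<open>\<otimes>\<close> 75) where
  "f \<otimes> g = (\<lambda>(u, v). f u * g v)"

section \<open>The monomial basis and the coproduct\<close>

definition rho :: "nat list \<Rightarrow> nat set list" where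
  "rho w = map (\<lambda>j. {i \<in> {1..length w}. card {a \<in> set w. a < w ! (i - 1)} + 1 = j})
             [1..<Suc (card (set w))]"

definition M :: "nat set list \<Rightarrow> 'a::comm_ring_1 ncseries" where
  "M \<Phi> = (\<lambda>w. if rho w = \<Phi> then 1 else 0)"

definition NCQSym :: "'a::comm_ring_1 ncseries set" where
  "NCQSym = module.span scale {M \<Phi> | \<Phi> n. set_composition n \<Phi>}"

text \<open>An element of \<open>NCQSym\<close> has the same coefficient at all words \<open>w\<close> with \<open>rho w = \<Phi>\<close>; this is
  its coefficient at \<open>M \<Phi>\<close>.\<close>

definition M_coeff :: "'a::comm_ring_1 ncseries \<Rightarrow> nat set list \<Rightarrow> 'a" where
  "M_coeff f \<Phi> = f (SOME w. rho w = \<Phi>)"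

text \<open>The coproduct of \<open>NCQSym\<close> is the linear map with
  $\Delta(M_{B_1|\cdots|B_k}) =
     \sum_{i=0}^k M_{st(B_1|\cdots|B_i)} \otimes M_{st(B_{i+1}|\cdots|B_k)}$.
  It is written out by expanding in the monomial basis; the lemmas below (\<open>coproduct_M\<close>,
  \<open>coproduct_add\<close>, \<open>coproduct_scale\<close>) confirm that it is this map.  Outside \<open>NCQSym\<close> the value
  is irrelevant.\<close>

definition coproduct :: "'a::comm_ring_1 ncseries \<Rightarrow> nat list \<times> nat list \<Rightarrow> 'a"  (\<open>\<Delta>\<close>) where
  "\<Delta> f = (\<Sum>\<Phi> \<in> {\<Phi>. (\<exists>n. set_composition n \<Phi>) \<and> M_coeff f \<Phi> \<noteq> 0}.
            scale (M_coeff f \<Phi>) (\<Sum>i=0..length \<Phi>. M (st (take i \<Phi>)) \<otimes> M (st (drop i \<Phi>))))"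

section \<open>Labelled diagonal descending fillings\<close>

definition D_greater :: "nat set \<Rightarrow> nat set \<Rightarrow> bool"  (infix \<open>>\<^sub>D\<close> 50) where
  "A >\<^sub>D B \<longleftrightarrow> card A > card B \<or> (card A = card B \<and> Min A < Min B)"

text \<open>Row \<open>i\<close> of the matrix of a filling contains the \<open>i\<close>-th block and nothing else, so a filling
  is recorded by the list \<open>c\<close> of the (1-based) column numbers of the blocks.\<close>

definition LDD :: "nat set list \<Rightarrow> nat list set" where
  "LDD \<Phi> = {c. length c = length \<Phi> \<and> (c \<noteq> [] \<longrightarrow> c ! 0 = 1) \<and>
     (\<forall>i. Suc i < length \<Phi> \<longrightarrow>
        (c ! Suc i = c ! i \<and> \<Phi> ! i >\<^sub>D \<Phi> ! Suc i) \<or> c ! Suc i = Suc (c ! i))}"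

definition col :: "nat set list \<Rightarrow> nat list \<Rightarrow> nat set list" where
  "col \<Phi> c = map (\<lambda>j. \<Union>i \<in> {i. i < length \<Phi> \<and> c ! i = j}. \<Phi> ! i) [1..<Suc (Max (insert 0 (set c)))]"

definition P :: "nat set list \<Rightarrow> 'a::comm_ring_1 ncseries" where
  "P \<Phi> = (\<Sum>c \<in> LDD \<Phi>. M (col \<Phi> c))"

section \<open>Adequacy of the definitions\<close>

lemma set_mset_shuffle: "set_mset (shuffle xs ys) = shuffles xs ys"
  by (induction xs ys rule: shuffle.induct) auto

lemma finite_LDD: "finite (LDD \<Phi>)"
proof -
  have bound: "c ! i \<le> Suc i" if "c \<in> LDD \<Phi>" "i < length \<Phi>" for c i
    using that(2)
  proof (induction i)
    case 0
    then show ?case using that(1) by (auto simp: LDD_def)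
  next
    case (Suc i)
    have "c ! Suc i = c ! i \<or> c ! Suc i = Suc (c ! i)"
      using that(1) Suc.prems unfolding LDD_def by blast
    then show ?case using Suc by auto
  qed
  have "LDD \<Phi> \<subseteq> {c. set c \<subseteq> {..length \<Phi>} \<and> length c = length \<Phi>}"
  proof
    fix c assume c: "c \<in> LDD \<Phi>"
    then have len: "length c = length \<Phi>" by (simp add: LDD_def)
    have "x \<le> length \<Phi>" if "x \<in> set c" for x
    proof -
      obtain i where i: "i < length c" "c ! i = x" using \<open>x \<in> set c\<close> by (metis in_set_conv_nth)
      then show ?thesis using bound[OF c, of i] len by simp
    qed
    then show "c \<in> {c. set c \<subseteq> {..length \<Phi>} \<and> length c = length \<Phi>}" using len by auto
  qed
  then show ?thesis
    by (rule finite_subset) (auto intro: finite_lists_length_eq)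
qed

lemma set_composition_Union:
  assumes "set_composition n \<Phi>"
  shows "(\<Union>i<length \<Phi>. \<Phi> ! i) = {1..n}"
proof -
  have sub: "\<Phi> ! i \<subseteq> {1..n}" if "i < length \<Phi>" for i
    using assms that by (auto simp: set_composition_def)
  then have fin: "finite (\<Phi> ! i)" if "i < length \<Phi>" for i
    using that finite_subset by blast
  have "card (\<Union>i<length \<Phi>. \<Phi> ! i) = (\<Sum>i<length \<Phi>. card (\<Phi> ! i))"
    using assms fin by (intro card_UN_disjoint')
      (auto simp: set_composition_def)
  also have "\<dots> = (\<Sum>B\<leftarrow>\<Phi>. card B)"
    by (simp add: sum_list_sum_nth atLeast0LessThan)
  finally have "card (\<Union>i<length \<Phi>. \<Phi> ! i) = card {1..n}"
    using assms by (simp add: set_composition_def)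
  then show ?thesis using sub by (intro card_subset_eq) auto
qed

lemma rho_surj:
  assumes "set_composition n \<Phi>"
  shows "\<exists>w. rho w = \<Phi>"
proof -
  define b where "b i = (THE j. j < length \<Phi> \<and> i \<in> \<Phi> ! j)" for i
  define w where "w = map b [1..<Suc n]"
  have b: "b i = j" if "j < length \<Phi>" "i \<in> \<Phi> ! j" for i j
    unfolding b_def using that assms
    by (intro the_equality) (auto simp: set_composition_def disjoint_family_on_def)
  have ne: "\<Phi> ! j \<noteq> {}" if "j < length \<Phi>" for j
    using assms that by (auto simp: set_composition_def)
  have U: "(\<Union>i<length \<Phi>. \<Phi> ! i) = {1..n}"
    using set_composition_Union[OF assms] .
  have iff: "b i = j \<longleftrightarrow> i \<in> \<Phi> ! j" if "i \<in> {1..n}" "j < length \<Phi>" for i j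
    using b that U by blast
  have blt: "b i < length \<Phi>" if "i \<in> {1..n}" for i
    using b that U by blast
  have "b ` {1..n} = {..<length \<Phi>}"
  proof (intro equalityI subsetI)
    fix j assume "j \<in> {..<length \<Phi>}"
    then obtain i where "i \<in> \<Phi> ! j" "j < length \<Phi>" using ne by auto
    moreover have "i \<in> {1..n}" using calculation U by blast
    ultimately show "j \<in> b ` {1..n}" using b by blast
  qed (use blt in auto)
  then have sw: "set w = {..<length \<Phi>}"
    by (simp add: w_def atLeastLessThanSuc_atLeastAtMost del: upt_Suc)
  have wi: "w ! (i - 1) = b i" if "i \<in> {1..n}" for i
  proof -
    have "w ! (i - 1) = b ([1..<Suc n] ! (i - 1))"
      unfolding w_def using that by (intro nth_map) auto
    also have "[1..<Suc n] ! (i - 1) = i"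
      using that by (subst nth_upt) auto
    finally show ?thesis .
  qed
  have cnt: "card {a \<in> set w. a < w ! (i - 1)} = b i" if "i \<in> {1..n}" for i
  proof -
    have "{a \<in> set w. a < w ! (i - 1)} = {..<b i}"
      unfolding wi[OF that] sw using blt[OF that] by auto
    then show ?thesis by simp
  qed
  have "rho w = map (\<lambda>j. {i \<in> {1..n}. b i + 1 = j}) [1..<Suc (length \<Phi>)]"
  proof -
    have lw: "length w = n" by (simp add: w_def)
    have cs: "card (set w) = length \<Phi>" by (simp add: sw)
    have "{i \<in> {1..n}. card {a \<in> set w. a < w ! (i - 1)} + 1 = j} = {i \<in> {1..n}. b i + 1 = j}" for j
      using cnt by (intro Collect_cong conj_cong refl) simp
    then show ?thesis by (simp only: rho_def lw cs)
  qed
  also have "\<dots> = \<Phi>"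
  proof (rule nth_equalityI)
    show len: "length (map (\<lambda>j. {i \<in> {1..n}. b i + 1 = j}) [1..<Suc (length \<Phi>)]) = length \<Phi>"
      by (simp del: upt_Suc)
    fix j assume "j < length (map (\<lambda>j. {i \<in> {1..n}. b i + 1 = j}) [1..<Suc (length \<Phi>)])"
    then have j: "j < length \<Phi>" unfolding len .
    have "{i \<in> {1..n}. b i = j} = \<Phi> ! j"
    proof (intro equalityI subsetI)
      fix i assume "i \<in> \<Phi> ! j"
      moreover have "i \<in> {1..n}" using U j calculation by blast
      ultimately show "i \<in> {i \<in> {1..n}. b i = j}" using b[OF j] by blast
    qed (use iff j in blast)
    moreover have "[1..<Suc (length \<Phi>)] ! j = Suc j"
      using j by (subst nth_upt) auto
    ultimately show "map (\<lambda>j. {i \<in> {1..n}. b i + 1 = j}) [1..<Suc (length \<Phi>)] ! j = \<Phi> ! j"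
      using j by (subst nth_map) (simp_all del: upt_Suc)
  qed
  finally show ?thesis by blast
qed

lemma M_coeff_M:
  assumes "set_composition n \<Phi>"
  shows "M_coeff (M \<Psi>) \<Phi> = (if \<Phi> = \<Psi> then 1 else 0)"
  using someI_ex[OF rho_surj[OF assms]] by (simp add: M_coeff_def M_def)

lemma coproduct_M:
  assumes "set_composition n \<Phi>"
  shows "\<Delta> (M \<Phi> :: 'a::comm_ring_1 ncseries) =
           (\<Sum>i=0..length \<Phi>. M (st (take i \<Phi>)) \<otimes> M (st (drop i \<Phi>)))"
proof -
  have "{\<Psi>. (\<exists>n. set_composition n \<Psi>) \<and> M_coeff (M \<Phi> :: 'a ncseries) \<Psi> \<noteq> 0} = {\<Phi>}"
    using assms by (auto simp: M_coeff_M[where 'a = 'a] split: if_splits)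
  then show ?thesis
    using M_coeff_M[OF assms, of \<Phi>, where 'a = 'a] by (simp add: coproduct_def scale_def)
qed

interpretation scale: module "scale :: 'a::comm_ring_1 \<Rightarrow> ('w \<Rightarrow> 'a) \<Rightarrow> 'w \<Rightarrow> 'a"
  by unfold_locales (auto simp: scale_def algebra_simps fun_eq_iff)

lemma set_compositionI:
  assumes "\<And>i. i < length \<Phi> \<Longrightarrow> \<Phi> ! i \<noteq> {}"
    and "disjoint_family_on (\<lambda>i. \<Phi> ! i) {..<length \<Phi>}"
    and U: "(\<Union>i<length \<Phi>. \<Phi> ! i) = {1..n}"
  shows "set_composition n \<Phi>"
proof -
  have sub: "\<Phi> ! i \<subseteq> {1..n}" if "i < length \<Phi>" for i
    using U that by blast
  then have fin: "finite (\<Phi> ! i)" if "i < length \<Phi>" for i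
    using that finite_subset by blast
  have "(\<Sum>B\<leftarrow>\<Phi>. card B) = (\<Sum>i<length \<Phi>. card (\<Phi> ! i))"
    by (simp add: sum_list_sum_nth atLeast0LessThan)
  also have "\<dots> = card (\<Union>i<length \<Phi>. \<Phi> ! i)"
    using assms fin by (intro card_UN_disjoint'[symmetric]) auto
  finally have "(\<Sum>B\<leftarrow>\<Phi>. card B) = n" by (simp add: U)
  moreover have "\<forall>B \<in> set \<Phi>. B \<noteq> {} \<and> B \<subseteq> {1..n}"
  proof
    fix B assume "B \<in> set \<Phi>"
    then obtain i where "i < length \<Phi>" "B = \<Phi> ! i" by (auto simp: in_set_conv_nth)
    then show "B \<noteq> {} \<and> B \<subseteq> {1..n}" using assms(1) sub by simp
  qed
  ultimately show ?thesis
    using assms(2) by (simp add: set_composition_def)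
qed

lemma LDD_columns:
  assumes c: "c \<in> LDD \<Phi>"
  shows "set c = {1..Max (insert 0 (set c))}"
proof -
  have len: "length c = length \<Phi>" and c0: "c \<noteq> [] \<Longrightarrow> c ! 0 = 1"
    using c by (auto simp: LDD_def)
  have st: "c ! Suc i = c ! i \<or> c ! Suc i = Suc (c ! i)" if "Suc i < length c" for i
    using c that unfolding LDD_def by auto
  have ge: "c ! i \<ge> 1 \<and> {1..c ! i} \<subseteq> set c" if "i < length c" for i
    using that
  proof (induction i)
    case 0
    then have "c ! 0 = 1" using c0 by auto
    moreover have "c ! 0 \<in> set c" using 0 by (rule nth_mem)
    ultimately show ?case by auto
  next
    case (Suc i)
    then have IH: "c ! i \<ge> 1 \<and> {1..c ! i} \<subseteq> set c" by auto
    have "c ! Suc i \<in> set c" using Suc.prems by (rule nth_mem)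
    with IH st[OF Suc.prems] show ?case by (auto simp: atLeastAtMostSuc_conv)
  qed
  show ?thesis
  proof (cases "c = []")
    case False
    then have M: "Max (insert 0 (set c)) = Max (set c)" "Max (set c) \<in> set c"
      by auto
    then obtain i where i: "i < length c" "c ! i = Max (set c)"
      by (metis in_set_conv_nth)
    have "{1..Max (set c)} \<subseteq> set c"
      using ge[OF i(1)] unfolding i(2) by (rule conjunct2)
    moreover have "set c \<subseteq> {1..Max (set c)}"
    proof
      fix x assume x: "x \<in> set c"
      then obtain i where "i < length c" "c ! i = x" by (metis in_set_conv_nth)
      with ge[of i] have "1 \<le> x" by simp
      moreover have "x \<le> Max (set c)" using x by (rule Max_ge[OF finite_set])
      ultimately show "x \<in> {1..Max (set c)}" by simp
    qed
    ultimately show ?thesis unfolding M(1) by (rule equalityI[rotated])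
  qed simp
qed

lemma set_composition_col:
  assumes \<Phi>: "set_composition n \<Phi>" and c: "c \<in> LDD \<Phi>"
  shows "set_composition n (col \<Phi> c)"
proof (rule set_compositionI)
  let ?m = "Max (insert 0 (set c))"
  have len: "length c = length \<Phi>" using c by (auto simp: LDD_def)
  have lencol: "length (col \<Phi> c) = ?m" by (simp add: col_def)
  have nthcol: "col \<Phi> c ! j = (\<Union>i \<in> {i. i < length \<Phi> \<and> c ! i = Suc j}. \<Phi> ! i)"
    if "j < ?m" for j
    using that by (simp add: col_def del: upt_Suc)
  have setc: "set c = {1..?m}" by (rule LDD_columns[OF c])
  have ne: "\<Phi> ! j \<noteq> {}" if "j < length \<Phi>" for j
    using \<Phi> that by (auto simp: set_composition_def)
  show "col \<Phi> c ! j \<noteq> {}" if "j < length (col \<Phi> c)" for j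
  proof -
    have "Suc j \<in> set c" using that lencol by (subst setc) simp
    then obtain i where "i < length \<Phi>" "c ! i = Suc j"
      using len by (auto simp: in_set_conv_nth)
    then show ?thesis using ne nthcol that lencol by auto
  qed
  have dis: "i = j" if "i < length \<Phi>" "j < length \<Phi>" "x \<in> \<Phi> ! i" "x \<in> \<Phi> ! j" for i j x
    using \<Phi> that unfolding set_composition_def disjoint_family_on_def by blast
  show "disjoint_family_on (\<lambda>i. col \<Phi> c ! i) {..<length (col \<Phi> c)}"
    unfolding disjoint_family_on_def lencol
  proof (intro ballI impI)
    fix p q assume p: "p \<in> {..<?m}" and q: "q \<in> {..<?m}" and "p \<noteq> q"
    show "col \<Phi> c ! p \<inter> col \<Phi> c ! q = {}"
    proof (intro equals0I)
      fix x assume "x \<in> col \<Phi> c ! p \<inter> col \<Phi> c ! q"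
      with p q obtain i j where
        "i < length \<Phi>" "c ! i = Suc p" "x \<in> \<Phi> ! i" "j < length \<Phi>" "c ! j = Suc q" "x \<in> \<Phi> ! j"
        unfolding lessThan_iff by (auto simp only: nthcol UN_iff mem_Collect_eq Int_iff)
      with dis[of i j x] \<open>p \<noteq> q\<close> show False by simp
    qed
  qed
  have "(\<Union>j<length (col \<Phi> c). col \<Phi> c ! j) = (\<Union>i<length \<Phi>. \<Phi> ! i)"
  proof (intro equalityI subsetI)
    fix x assume "x \<in> (\<Union>i<length \<Phi>. \<Phi> ! i)"
    then obtain i where i: "i < length \<Phi>" "x \<in> \<Phi> ! i" by auto
    then have "c ! i \<in> set c" using len by simp
    then have "c ! i \<in> {1..?m}" by (subst (asm) setc)
    then have "c ! i - 1 < ?m" "Suc (c ! i - 1) = c ! i"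
      by (auto simp del: Max_insert)
    then show "x \<in> (\<Union>j<length (col \<Phi> c). col \<Phi> c ! j)"
      unfolding lencol using i nthcol by (intro UN_I[of "c ! i - 1"]) auto
  next
    fix x assume "x \<in> (\<Union>j<length (col \<Phi> c). col \<Phi> c ! j)"
    then show "x \<in> (\<Union>i<length \<Phi>. \<Phi> ! i)"
      unfolding lencol by (auto simp: nthcol simp del: Max_insert)
  qed
  then show "(\<Union>j<length (col \<Phi> c). col \<Phi> c ! j) = {1..n}"
    using set_composition_Union[OF \<Phi>] by simp
qed

lemma P_in_NCQSym:
  assumes "set_composition n \<Phi>"
  shows "P \<Phi> \<in> NCQSym"
proof -
  have "M (col \<Phi> c) \<in> {M \<Phi> | \<Phi> n. set_composition n \<Phi>}" if "c \<in> LDD \<Phi>" for c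
    using set_composition_col[OF assms that] by auto
  then show ?thesis
    unfolding P_def NCQSym_def by (intro scale.span_sum scale.span_base)
qed

lemma M_coeff_add: "M_coeff (f + g) \<Phi> = M_coeff f \<Phi> + M_coeff g \<Phi>"
  by (simp add: M_coeff_def)

lemma M_coeff_scale: "M_coeff (scale c f) \<Phi> = c * M_coeff f \<Phi>"
  by (simp add: M_coeff_def scale_def)

lemma finite_M_coeff:
  assumes "f \<in> NCQSym"
  shows "finite {\<Phi>. (\<exists>n. set_composition n \<Phi>) \<and> M_coeff f \<Phi> \<noteq> 0}"
  using assms unfolding NCQSym_def
proof (induction rule: scale.span_induct_alt)
  case base
  then show ?case by (simp add: M_coeff_def)
next
  case (step c x y)
  then obtain \<Psi> where x: "x = M \<Psi>" by blast
  have "{\<Phi>. (\<exists>n. set_composition n \<Phi>) \<and> M_coeff (scale c x + y) \<Phi> \<noteq> 0} \<subseteq>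
        insert \<Psi> {\<Phi>. (\<exists>n. set_composition n \<Phi>) \<and> M_coeff y \<Phi> \<noteq> 0}"
    by (auto simp: M_coeff_add M_coeff_scale x M_coeff_M)
  then show ?case using step finite_subset by blast
qed

lemma coproduct_superset:
  assumes "finite T" "T \<subseteq> {\<Phi>. \<exists>n. set_composition n \<Phi>}"
    and "{\<Phi>. (\<exists>n. set_composition n \<Phi>) \<and> M_coeff f \<Phi> \<noteq> 0} \<subseteq> T"
  shows "\<Delta> f = (\<Sum>\<Phi> \<in> T.
            scale (M_coeff f \<Phi>) (\<Sum>i=0..length \<Phi>. M (st (take i \<Phi>)) \<otimes> M (st (drop i \<Phi>))))"
  unfolding coproduct_def using assms
  by (intro sum.mono_neutral_left) auto

lemma coproduct_add:
  assumes "f \<in> NCQSym" "g \<in> NCQSym"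
  shows "\<Delta> (f + g) = \<Delta> f + \<Delta> g"
proof -
  let ?S = "\<lambda>f. {\<Phi>. (\<exists>n. set_composition n \<Phi>) \<and> M_coeff f \<Phi> \<noteq> 0}"
  define T where "T = ?S f \<union> ?S g"
  have T: "finite T" "T \<subseteq> {\<Phi>. \<exists>n. set_composition n \<Phi>}"
    unfolding T_def using assms finite_M_coeff by auto
  have "?S f \<subseteq> T" "?S g \<subseteq> T" "?S (f + g) \<subseteq> T"
    by (auto simp: T_def M_coeff_add)
  note this[THEN coproduct_superset[OF T]]
  then show ?thesis
    by (simp add: M_coeff_add scale.scale_left_distrib sum.distrib)
qed

lemma coproduct_scale:
  assumes "f \<in> NCQSym"
  shows "\<Delta> (scale c f) = scale c (\<Delta> f)"
proof -
  let ?S = "\<lambda>f. {\<Phi>. (\<exists>n. set_composition n \<Phi>) \<and> M_coeff f \<Phi> \<noteq> 0}"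
  have T: "finite (?S f)" "?S f \<subseteq> {\<Phi>. \<exists>n. set_composition n \<Phi>}"
    using assms finite_M_coeff by auto
  have "?S f \<subseteq> ?S f" "?S (scale c f) \<subseteq> ?S f"
    by (auto simp: M_coeff_scale)
  note this[THEN coproduct_superset[OF T]]
  then show ?thesis
    by (simp add: M_coeff_scale scale.scale_sum_right)
qed

end

(* The coefficient of P_Phi at a word w is 1 if w is constant on every block and the blocks are
   strictly increasing for the order "smaller letter first, ties broken by >_D", and 0 otherwise:
   the columns of a filling are then forced to be the ranks of the letters.  For a fixed word this
   order is total on the blocks of Phi and of the shifted Psi, so exactly one shuffle is sorted if
   both factors are sorted, and none otherwise; this is the product formula.

   For the coproduct, cutting a filling after its i-th column gives a filling of an initial segment
   of Phi and one of the complementary final segment.  Conversely any two such fillings can be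
   juxtaposed, since passing to a new column is always allowed. *)

theory Submission
  imports Defs
begin

section \<open>Set compositions by covering, and the block order \<open>>\<^sub>D\<close>\<close>

text \<open>The cardinality sum is traded for covering of \<open>{1..n}\<close>, which is easy to
  check for shuffles. \<open>distinct\<close> stands apart because
  \<open>disjoint (set \<Phi>)\<close> cannot detect a repeated block; such a block would be
  disjoint from itself, hence empty.\<close>

lemma set_composition_iff:
  "set_composition n \<Phi> \<longleftrightarrow>
     {} \<notin> set \<Phi> \<and> distinct \<Phi> \<and> disjoint (set \<Phi>) \<and> \<Union>(set \<Phi>) = {1..n}"
  (is "?L \<longleftrightarrow> ?R")
proof
  assume L: ?L
  then have ne: "{} \<notin> set \<Phi>" by (auto simp: set_composition_def)
  have dis: "\<Phi> ! i \<inter> \<Phi> ! j = {}" if "i < length \<Phi>" "j < length \<Phi>" "i \<noteq> j" for i j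
    using L that by (auto simp: set_composition_def disjoint_family_on_def)
  have "distinct \<Phi>"
    unfolding distinct_conv_nth
  proof (intro allI impI notI)
    fix i j assume "i < length \<Phi>" "j < length \<Phi>" "i \<noteq> j" "\<Phi> ! i = \<Phi> ! j"
    then show False using dis[of i j] ne nth_mem[of i \<Phi>] by simp
  qed
  moreover have "disjoint (set \<Phi>)"
    using dis by (auto simp: disjoint_def in_set_conv_nth) blast+
  moreover have "\<Union>(set \<Phi>) = {1..n}"
    using set_composition_Union[OF L] by (simp add: set_conv_nth) blast
  ultimately show ?R using ne by blast
next
  assume R: ?R
  show ?L
  proof (rule set_compositionI)
    show "\<Phi> ! i \<noteq> {}" if "i < length \<Phi>" for i using R that by (metis nth_mem)
    show "disjoint_family_on (\<lambda>i. \<Phi> ! i) {..<length \<Phi>}"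
      using R by (auto simp: disjoint_family_on_def disjoint_def nth_eq_iff_index_eq)
    show "(\<Union>i<length \<Phi>. \<Phi> ! i) = {1..n}"
      using R by (simp add: set_conv_nth) blast
  qed
qed

lemma D_greater_trans: "A >\<^sub>D B \<Longrightarrow> B >\<^sub>D C \<Longrightarrow> A >\<^sub>D C"
  by (auto simp: D_greater_def)

lemma D_greater_asym: "A >\<^sub>D B \<Longrightarrow> \<not> B >\<^sub>D A"
  by (auto simp: D_greater_def)

text \<open>Disjoint nonempty sets have different minima, so the tie-break always decides.\<close>

lemma D_greater_total:
  assumes "finite A" "finite B" "A \<noteq> {}" "B \<noteq> {}" "A \<inter> B = {}"
  shows "A >\<^sub>D B \<or> B >\<^sub>D A"
proof -
  have "Min A \<noteq> Min B" using assms by (metis Min_in disjoint_iff)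
  then show ?thesis by (auto simp: D_greater_def)
qed

lemma Min_image_strict_mono:
  fixes A :: "'a::linorder set" and f :: "'a \<Rightarrow> 'b::linorder"
  assumes "strict_mono_on A f" "finite A" "A \<noteq> {}"
  shows "Min (f ` A) = f (Min A)"
proof (rule Min_eqI)
  show "f (Min A) \<le> y" if "y \<in> f ` A" for y
    using that assms strict_mono_on_leD[OF assms(1), of "Min A"] by auto
qed (use assms in auto)

text \<open>An increasing map keeps cardinalities and commutes with \<open>Min\<close>, the data
  that \<open>>\<^sub>D\<close> compares. Serves shifts and standardization alike.\<close>

lemma D_greater_image_iff:
  assumes "strict_mono_on U f" "A \<subseteq> U" "B \<subseteq> U"
    and "finite A" "finite B" "A \<noteq> {}" "B \<noteq> {}"
  shows "f ` A >\<^sub>D f ` B \<longleftrightarrow> A >\<^sub>D B"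
proof -
  have sm: "strict_mono_on A f" "strict_mono_on B f"
    using assms(1-3) by (blast intro: monotone_on_subset)+
  have "card (f ` A) = card A" "card (f ` B) = card B"
    using sm by (auto intro!: card_image strict_mono_on_imp_inj_on)
  moreover have "f (Min A) < f (Min B) \<longleftrightarrow> Min A < Min B"
    using assms by (intro strict_mono_on_less[OF assms(1)]) (auto intro: Min_in)
  ultimately show ?thesis
    unfolding D_greater_def
    using Min_image_strict_mono[OF sm(1)] Min_image_strict_mono[OF sm(2)] assms by metis
qed

section \<open>Fillings and their columns under relabelling of elements\<close>

lemma LDD_map_image:
  assumes "strict_mono_on (\<Union>(set \<Phi>)) f" "\<And>B. B \<in> set \<Phi> \<Longrightarrow> finite B \<and> B \<noteq> {}"
  shows "LDD (map ((`) f) \<Phi>) = LDD \<Phi>"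
proof -
  have "f ` (\<Phi> ! i) >\<^sub>D f ` (\<Phi> ! Suc i) \<longleftrightarrow> \<Phi> ! i >\<^sub>D \<Phi> ! Suc i" if "Suc i < length \<Phi>" for i
    using that assms(2)[of "\<Phi> ! i"] assms(2)[of "\<Phi> ! Suc i"]
    by (intro D_greater_image_iff[OF assms(1)]) (simp_all add: Union_upper)
  then show ?thesis
    unfolding LDD_def by (intro Collect_cong) (simp cong: conj_cong imp_cong)
qed

text \<open>Each column depends only on a set of pairs (block, column number), so concatenating
  fillings becomes a union of such sets.\<close>

lemma col_conv_zip:
  assumes "length c = length \<Phi>"
  shows "col \<Phi> c = map (\<lambda>j. \<Union>{B. (B, j) \<in> set (zip \<Phi> c)}) [1..<Suc (Max (insert 0 (set c)))]"
  unfolding col_def using assms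
  by (intro map_cong refl) (simp only: set_zip min.idem, blast)

lemma col_map_image:
  "col (map ((`) f) \<Phi>) c = map ((`) f) (col \<Phi> c)"
  unfolding col_def map_map length_map comp_def image_UN
  by (intro map_cong refl SUP_cong) simp

text \<open>The column numbers of a filling are exactly \<open>1\<close> up to their maximum, so
  every block lands in a listed column.\<close>

lemma Union_col:
  assumes "c \<in> LDD \<Phi>"
  shows "\<Union>(set (col \<Phi> c)) = \<Union>(set \<Phi>)"
proof -
  have len: "length c = length \<Phi>" using assms by (simp add: LDD_def)
  have "set [1..<Suc (Max (insert 0 (set c)))] = set c"
    using LDD_columns[OF assms, symmetric] by (simp only: set_upt atLeastLessThanSuc_atLeastAtMost)
  then have "\<Union>(set (col \<Phi> c)) = (\<Union>j\<in>set c. \<Union>{B. (B, j) \<in> set (zip \<Phi> c)})"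
    by (simp only: col_conv_zip[OF len] set_map)
  also have "\<dots> = \<Union>(fst ` set (zip \<Phi> c))"
    by auto (meson set_zip_rightD)
  also have "fst ` set (zip \<Phi> c) = set \<Phi>"
    using len by (metis map_fst_zip set_map)
  finally show ?thesis .
qed

section \<open>Coefficients of \<open>P\<close> on words, via the ranks of their letters\<close>

section \<open>The coefficients of \<open>P\<close>\<close>

text \<open>Elements of blocks are positions counted from 1, while \<open>!\<close> counts from 0.
  The smallest position represents the block; on a word constant on the block every position gives
  the same letter.\<close>

definition letter :: "nat list \<Rightarrow> nat set \<Rightarrow> nat" where
  "letter w B = w ! (Min B - 1)"

definition precedes :: "nat list \<Rightarrow> nat set \<Rightarrow> nat set \<Rightarrow> bool" where
  "precedes w A B \<longleftrightarrow> letter w A < letter w B \<or> letter w A = letter w B \<and> A >\<^sub>D B"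

definition constant_on_blocks :: "nat list \<Rightarrow> nat set list \<Rightarrow> bool" where
  "constant_on_blocks w \<Phi> \<longleftrightarrow> (\<forall>B \<in> set \<Phi>. \<forall>x \<in> B. w ! (x - 1) = letter w B)"

text \<open>The number of the block of \<open>rho w\<close> that holds the positions of the letter
  \<open>a\<close>; it becomes the column number once \<open>col \<Phi> c = rho w\<close>.\<close>

definition rank :: "nat list \<Rightarrow> nat \<Rightarrow> nat" where
  "rank w a = Suc (card {b \<in> set w. b < a})"

lemma rank_strict_mono: "strict_mono_on (set w) (rank w)"
proof (rule strict_mono_onI)
  fix a b assume "a \<in> set w" "b \<in> set w" "a < b"
  then have "{x \<in> set w. x < a} \<subset> {x \<in> set w. x < b}" by auto
  then show "rank w a < rank w b" by (simp add: rank_def psubset_card_mono)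
qed

lemma rank_image: "rank w ` set w = {1..card (set w)}"
proof (rule card_subset_eq)
  show "rank w ` set w \<subseteq> {1..card (set w)}"
  proof
    fix j assume "j \<in> rank w ` set w"
    then obtain a where a: "a \<in> set w" "j = rank w a" by auto
    then have "{b \<in> set w. b < a} \<subset> set w" by auto
    then have "card {b \<in> set w. b < a} < card (set w)" by (simp add: psubset_card_mono)
    then show "j \<in> {1..card (set w)}" using a by (auto simp: rank_def)
  qed
  show "card (rank w ` set w) = card {1..card (set w)}"
    using card_image[OF strict_mono_on_imp_inj_on[OF rank_strict_mono[of w]]] by simp
qed simp

lemma rho_rank:
  "rho w = map (\<lambda>j. {i \<in> {1..length w}. rank w (w ! (i - 1)) = j}) [1..<Suc (card (set w))]"
  by (simp add: rho_def rank_def del: upt_Suc)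

lemma Union_rho: "\<Union>(set (rho w)) = {1..length w}"
proof -
  have "rank w (w ! (i - 1)) \<in> {1..card (set w)}" if "i \<in> {1..length w}" for i
    using that by (subst rank_image[symmetric]) auto
  then show ?thesis by (fastforce simp: rho_rank simp del: upt_Suc)
qed

text \<open>Transitivity lets sortedness be tested on neighbouring blocks, which is the form of the
  condition in \<open>LDD\<close>.\<close>

lemma precedes_trans: "transp (precedes w)"
  by (rule transpI) (auto simp: precedes_def intro: D_greater_trans)

lemma precedes_asym: "precedes w A B \<Longrightarrow> \<not> precedes w B A"
  by (auto simp: precedes_def dest: D_greater_asym)

text \<open>No value of the interval is missed, so sortedness forbids a late start or a jump. This
  makes the ranks of sorted blocks legal column numbers.\<close>

lemma sorted_interval_steps:
  fixes c :: "nat list"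
  assumes "sorted c" "set c = {1..k}"
  shows "c \<noteq> [] \<Longrightarrow> c ! 0 = 1"
    and "Suc i < length c \<Longrightarrow> c ! Suc i = c ! i \<or> c ! Suc i = Suc (c ! i)"
proof -
  assume ne: "c \<noteq> []"
  then have c0: "c ! 0 \<in> {1..k}" using nth_mem[of 0 c] assms(2) by simp
  then have "1 \<in> set c" using assms(2) by simp
  then obtain p where "p < length c" "c ! p = 1" by (auto simp: in_set_conv_nth)
  then have "c ! 0 \<le> 1" using sorted_nth_mono[OF assms(1), of 0 p] by simp
  then show "c ! 0 = 1" using c0 by simp
next
  assume i: "Suc i < length c"
  have le: "c ! i \<le> c ! Suc i" using sorted_nth_mono[OF assms(1), of i "Suc i"] i by simp
  have "c ! Suc i \<in> set c" using i by simp
  then have "c ! Suc i \<le> k" unfolding assms(2) by simp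
  have "c ! Suc i \<le> Suc (c ! i)"
  proof (rule ccontr)
    assume gt: "\<not> ?thesis"
    \<comment> \<open>A skipped value would still occur at some \<open>p\<close>, but sortedness
      excludes both \<open>p \<le> i\<close> and \<open>p > i\<close>.\<close>
    then have "Suc (c ! i) \<in> set c" using \<open>c ! Suc i \<le> k\<close> unfolding assms(2) by simp
    then obtain p where p: "p < length c" "c ! p = Suc (c ! i)" by (auto simp: in_set_conv_nth)
    show False
    proof (cases "p \<le> i")
      case True
      then show False using sorted_nth_mono[OF assms(1), of p i] i p by simp
    next
      case False
      then show False using sorted_nth_mono[OF assms(1), of "Suc i" p] p gt by simp
    qed
  qed
  then show "c ! Suc i = c ! i \<or> c ! Suc i = Suc (c ! i)" using le by linarith
qed

lemma rank_less_iff: "a \<in> set w \<Longrightarrow> b \<in> set w \<Longrightarrow> rank w a < rank w b \<longleftrightarrow> a < b"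
  by (rule strict_mono_on_less[OF rank_strict_mono])

lemma rank_eq_iff: "a \<in> set w \<Longrightarrow> b \<in> set w \<Longrightarrow> rank w a = rank w b \<longleftrightarrow> a = b"
  by (rule strict_mono_on_eq[OF rank_strict_mono])

text \<open>Equal columns correspond to equal letters, and then the condition in \<open>LDD\<close>
  is the tie-break of \<open>precedes\<close>; a new column corresponds to a larger letter. Hence
  the word determines the filling.\<close>

lemma col_eq_rho_iff:
  assumes \<Phi>: "set_composition n \<Phi>"
  shows "c \<in> LDD \<Phi> \<and> col \<Phi> c = rho w \<longleftrightarrow>
    length w = n \<and> constant_on_blocks w \<Phi> \<and> sorted_wrt (precedes w) \<Phi> \<and>
    c = map (\<lambda>B. rank w (letter w B)) \<Phi>"
  (is "?L \<longleftrightarrow> ?R")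
proof -
  have U: "\<Union>(set \<Phi>) = {1..n}" and ne: "{} \<notin> set \<Phi>"
    using \<Phi> unfolding set_composition_iff by blast+
  have Min: "Min B \<in> B" if "B \<in> set \<Phi>" for B
  proof (rule Min_in)
    show "finite B" using that U by (metis Union_upper finite_atLeastAtMost finite_subset)
    show "B \<noteq> {}" using that ne by auto
  qed
  show ?thesis
  proof
    assume L: ?L
    then have c: "c \<in> LDD \<Phi>" and eq: "col \<Phi> c = rho w" by auto
    have len: "length c = length \<Phi>" using c by (simp add: LDD_def)
    \<comment> \<open>Comparing what the two compositions cover gives the length of
      \<open>w\<close>; comparing their lengths then shows that there are as many columns as
      distinct letters.\<close>
    have "{1..n} = {1..length w}"
      using Union_col[OF c] U Union_rho[of w] eq by metis
    then have w: "length w = n" by (metis card_atLeastAtMost diff_Suc_1)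
    define k where "k = card (set w)"
    have k: "Max (insert 0 (set c)) = k"
      using arg_cong[OF eq, of length] unfolding col_def rho_rank k_def length_map length_upt by simp
    \<comment> \<open>The column containing block \<open>i\<close> equals the block of
      \<open>rho w\<close> with the same number, that is, the positions whose letter has rank
      \<open>c ! i\<close>.\<close>
    have rank: "rank w (w ! (x - 1)) = c ! i" if "i < length \<Phi>" "x \<in> \<Phi> ! i" for i x
    proof -
      have "c ! i \<in> set c" using that len by simp
      then have "c ! i \<in> set [1..<Suc k]" using LDD_columns[OF c] k by auto
      moreover have "map (\<lambda>j. \<Union>{B. (B, j) \<in> set (zip \<Phi> c)}) [1..<Suc k] =
          map (\<lambda>j. {i \<in> {1..length w}. rank w (w ! (i - 1)) = j}) [1..<Suc k]"
        using eq unfolding col_conv_zip[OF len] rho_rank k k_def[symmetric] .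
      ultimately have "\<Union>{B. (B, c ! i) \<in> set (zip \<Phi> c)} =
          {x \<in> {1..length w}. rank w (w ! (x - 1)) = c ! i}"
        unfolding map_eq_conv by blast
      moreover have "(\<Phi> ! i, c ! i) \<in> set (zip \<Phi> c)"
        using that len by (metis in_set_zip fst_conv snd_conv)
      ultimately show ?thesis using that(2) by blast
    qed
    have mem: "w ! (x - 1) \<in> set w" if "x \<in> B" "B \<in> set \<Phi>" for x B
    proof -
      have "x \<in> {1..n}" using that U by blast
      then show ?thesis using w by (intro nth_mem) auto
    qed
    have letter: "letter w B \<in> set w" if "B \<in> set \<Phi>" for B
      unfolding letter_def using that Min mem by blast
    have rl: "rank w (letter w (\<Phi> ! i)) = c ! i" if "i < length \<Phi>" for i
      unfolding letter_def using rank[OF that] Min that by simp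
    have "constant_on_blocks w \<Phi>"
      unfolding constant_on_blocks_def
    proof (intro ballI)
      fix B x assume B: "B \<in> set \<Phi>" "x \<in> B"
      then obtain i where "i < length \<Phi>" "B = \<Phi> ! i" by (auto simp: in_set_conv_nth)
      then have "rank w (w ! (x - 1)) = rank w (letter w B)" using rank rl B by simp
      then show "w ! (x - 1) = letter w B" using mem[OF B(2,1)] letter[OF B(1)] rank_eq_iff by metis
    qed
    moreover have "sorted_wrt (precedes w) \<Phi>"
      unfolding sorted_wrt_iff_nth_Suc_transp[OF precedes_trans]
    proof (intro allI impI)
      fix i assume i: "Suc i < length \<Phi>"
      then have l: "letter w (\<Phi> ! i) \<in> set w" "letter w (\<Phi> ! Suc i) \<in> set w"
        using letter by simp_all
      have "(c ! Suc i = c ! i \<and> \<Phi> ! i >\<^sub>D \<Phi> ! Suc i) \<or> c ! Suc i = Suc (c ! i)"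
        using c i unfolding LDD_def by blast
      then show "precedes w (\<Phi> ! i) (\<Phi> ! Suc i)"
        unfolding precedes_def rank_less_iff[OF l, symmetric] rank_eq_iff[OF l, symmetric]
          rl[OF i] rl[OF Suc_lessD[OF i]] by (elim disjE) simp_all
    qed
    moreover have "c = map (\<lambda>B. rank w (letter w B)) \<Phi>"
      using len rl by (intro nth_equalityI) simp_all
    ultimately show ?R using w by blast
  next
    assume R: ?R
    then have w: "length w = n" and const: "constant_on_blocks w \<Phi>"
      and srt: "sorted_wrt (precedes w) \<Phi>" and c: "c = map (\<lambda>B. rank w (letter w B)) \<Phi>" by auto
    \<comment> \<open>The blocks cover all positions and \<open>w\<close> is constant on each, so no
      letter is missed.\<close>
    have letters: "letter w ` set \<Phi> = set w"
    proof (intro equalityI subsetI)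
      fix a assume "a \<in> letter w ` set \<Phi>"
      then obtain B where B: "B \<in> set \<Phi>" "a = w ! (Min B - 1)" by (auto simp: letter_def)
      then have "Min B \<in> {1..n}" using Min U by blast
      then show "a \<in> set w" using B w by (auto intro!: nth_mem)
    next
      fix a assume "a \<in> set w"
      then obtain i where i: "i < n" "a = w ! i" using w by (auto simp: in_set_conv_nth)
      then have "Suc i \<in> \<Union>(set \<Phi>)" unfolding U by simp
      then obtain B where B: "B \<in> set \<Phi>" "Suc i \<in> B" by blast
      then have "a = letter w B" using const i unfolding constant_on_blocks_def by fastforce
      then show "a \<in> letter w ` set \<Phi>" using B by blast
    qed
    have setc: "set c = {1..card (set w)}"
    proof -
      have "set c = rank w ` letter w ` set \<Phi>" by (simp add: c image_image)
      then show ?thesis unfolding letters rank_image .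
    qed
    have "sorted c"
      unfolding c sorted_wrt_map
    proof (rule sorted_wrt_mono_rel[OF _ srt])
      fix A B assume "A \<in> set \<Phi>" "B \<in> set \<Phi>" "precedes w A B"
      moreover have "letter w A \<in> set w" "letter w B \<in> set w" using calculation letters by auto
      ultimately show "rank w (letter w A) \<le> rank w (letter w B)"
        unfolding precedes_def by (metis less_imp_le order_refl rank_less_iff)
    qed
    note steps = sorted_interval_steps[OF this setc]
    have "c \<in> LDD \<Phi>"
      unfolding LDD_def
    proof (intro CollectI conjI impI allI)
      show "length c = length \<Phi>" by (simp add: c)
      show "c ! 0 = 1" if "c \<noteq> []" using steps(1) that .
      fix i assume i: "Suc i < length \<Phi>"
      have p: "precedes w (\<Phi> ! i) (\<Phi> ! Suc i)"
        using srt i unfolding sorted_wrt_iff_nth_Suc_transp[OF precedes_trans] by blast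
      have l: "letter w (\<Phi> ! i) \<in> set w" "letter w (\<Phi> ! Suc i) \<in> set w"
        unfolding letters[symmetric] by (intro imageI nth_mem; use i in simp)+
      show "(c ! Suc i = c ! i \<and> \<Phi> ! i >\<^sub>D \<Phi> ! Suc i) \<or> c ! Suc i = Suc (c ! i)"
      \<comment> \<open>Equal column numbers mean equal letters, so \<open>precedes\<close> can only
        hold by \<open>>\<^sub>D\<close>; otherwise the ranks advance by one.\<close>
      proof (cases "c ! Suc i = c ! i")
        case True
        then have "letter w (\<Phi> ! i) = letter w (\<Phi> ! Suc i)"
          using i rank_eq_iff[OF l] by (simp add: c)
        then show ?thesis using True p by (simp add: precedes_def)
      next
        case False
        then show ?thesis using steps(2)[of i] i by (simp add: c)
      qed
    qed
    moreover have "col \<Phi> c = rho w"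
    proof -
      \<comment> \<open>The inserted \<open>0\<close> supplies the value for the empty word, which
        has no letters and no columns.\<close>
      have "Max (insert 0 (set c)) = card (set w)"
        unfolding setc by (intro Max_eqI) (auto simp: Suc_le_eq)
      moreover have "\<Union>{B. (B, j) \<in> set (zip \<Phi> c)} =
          {i \<in> {1..length w}. rank w (w ! (i - 1)) = j}" for j
      proof -
        have "\<Union>{B. (B, j) \<in> set (zip \<Phi> c)} = \<Union>{B \<in> set \<Phi>. rank w (letter w B) = j}"
          by (auto simp: c zip_map2 zip_same_conv_map)
        also have "\<dots> = {i \<in> \<Union>(set \<Phi>). rank w (w ! (i - 1)) = j}"
          using const unfolding constant_on_blocks_def by fastforce
        finally show ?thesis unfolding U w .
      qed
      moreover have "length c = length \<Phi>" by (simp add: c)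
      ultimately show ?thesis unfolding rho_rank by (simp only: col_conv_zip)
    qed
    ultimately show ?L by blast
  qed
qed

lemma sum_fun_apply: "(\<Sum>i\<in>I. f i) x = (\<Sum>i\<in>I. f i x)"
  by (induction I rule: infinite_finite_induct) auto

text \<open>By \<open>col_eq_rho_iff\<close> at most one filling contributes at \<open>w\<close>,
  the one given by the ranks of the letters.\<close>

lemma P_apply:
  assumes "set_composition n \<Phi>"
  shows "P \<Phi> w =
    of_bool (length w = n \<and> constant_on_blocks w \<Phi> \<and> sorted_wrt (precedes w) \<Phi>)"
proof -
  let ?Q = "length w = n \<and> constant_on_blocks w \<Phi> \<and> sorted_wrt (precedes w) \<Phi>"
  have "P \<Phi> w = (\<Sum>c \<in> LDD \<Phi>. of_bool (col \<Phi> c = rho w))"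
    unfolding P_def sum_fun_apply M_def of_bool_def by (intro sum.cong) auto
  also have "\<dots> = of_nat (card {c \<in> LDD \<Phi>. col \<Phi> c = rho w})"
    using finite_LDD[of \<Phi>] by (simp add: Int_def)
  also have "{c \<in> LDD \<Phi>. col \<Phi> c = rho w} =
      (if ?Q then {map (\<lambda>B. rank w (letter w B)) \<Phi>} else {})"
    unfolding col_eq_rho_iff[OF assms] by auto
  finally show ?thesis by (cases ?Q) (simp_all only: if_True if_False, simp_all)
qed

section \<open>Product: splitting words and counting sorted shuffles\<close>

section \<open>Products\<close>

lemma sum_mset_fun_apply: "(\<Sum>i\<in>#I. f i) x = (\<Sum>i\<in>#I. f i x)"
  by (induction I) auto

text \<open>A sorted shuffle must begin with the smaller of the two heads, so only one branch of the
  recursion can contribute.\<close>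

lemma sum_shuffle_sorted_wrt:
  assumes "transp R" "\<And>x y. R x y \<Longrightarrow> \<not> R y x"
    and "\<And>x y. x \<in> set xs \<Longrightarrow> y \<in> set ys \<Longrightarrow> R x y \<or> R y x"
  shows "(\<Sum>zs \<in># shuffle xs ys. of_bool (sorted_wrt R zs)) =
    (of_bool (sorted_wrt R xs \<and> sorted_wrt R ys) :: 'a::comm_ring_1)"
  using assms(3)
proof (induction xs ys rule: shuffle.induct)
  case (3 x xs y ys)
  let ?s = "\<lambda>zs. of_bool (sorted_wrt R zs) :: 'a"
  \<comment> \<open>All shuffles of \<open>us\<close> and \<open>vs\<close> have the same elements,
    so the condition that \<open>z\<close> comes before them is a common factor.\<close>
  have cons: "(\<Sum>zs \<in># shuffle us vs. ?s (z # zs)) =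
      of_bool (\<forall>u \<in> set us \<union> set vs. R z u) * (\<Sum>zs \<in># shuffle us vs. ?s zs)" for z us vs
  proof -
    have "(\<Sum>zs \<in># shuffle us vs. ?s (z # zs)) =
        (\<Sum>zs \<in># shuffle us vs. of_bool (\<forall>u \<in> set us \<union> set vs. R z u) * ?s zs)"
    proof (intro arg_cong[of _ _ sum_mset] image_mset_cong)
      fix zs assume "zs \<in># shuffle us vs"
      then have "set zs = set us \<union> set vs" by (intro set_shuffles) (simp add: set_mset_shuffle)
      then show "?s (z # zs) = of_bool (\<forall>u \<in> set us \<union> set vs. R z u) * ?s zs" by simp
    qed
    then show ?thesis by (simp add: sum_mset_distrib_left)
  qed
  have IH: "(\<Sum>zs \<in># shuffle xs (y # ys). ?s zs) = of_bool (sorted_wrt R xs \<and> sorted_wrt R (y # ys))"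
    "(\<Sum>zs \<in># shuffle (x # xs) ys. ?s zs) = of_bool (sorted_wrt R (x # xs) \<and> sorted_wrt R ys)"
    using 3 by auto
  have "(\<Sum>zs \<in># shuffle (x # xs) (y # ys). ?s zs) =
     of_bool (\<forall>u \<in> set xs \<union> set (y # ys). R x u) * of_bool (sorted_wrt R xs \<and> sorted_wrt R (y # ys)) +
     of_bool (\<forall>u \<in> set (x # xs) \<union> set ys. R y u) * of_bool (sorted_wrt R (x # xs) \<and> sorted_wrt R ys)"
    unfolding IH[symmetric] cons[symmetric] by (simp add: multiset.map_comp comp_def)
  also have "\<dots> = of_bool (sorted_wrt R (x # xs) \<and> sorted_wrt R (y # ys))"
  proof -
    \<comment> \<open>By transitivity, \<open>R x y\<close> puts \<open>x\<close> before all of the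
      sorted list \<open>y # ys\<close>; the claim for \<open>y\<close> is symmetric.\<close>
    have x: "(\<forall>u \<in> set xs \<union> set (y # ys). R x u) \<and> sorted_wrt R xs \<and> sorted_wrt R (y # ys) \<longleftrightarrow>
        R x y \<and> sorted_wrt R (x # xs) \<and> sorted_wrt R (y # ys)"
      using transpD[OF assms(1), of x y] by auto
    have y: "(\<forall>u \<in> set (x # xs) \<union> set ys. R y u) \<and> sorted_wrt R (x # xs) \<and> sorted_wrt R ys \<longleftrightarrow>
        R y x \<and> sorted_wrt R (x # xs) \<and> sorted_wrt R (y # ys)"
      using transpD[OF assms(1), of y x] by auto
    \<comment> \<open>Exactly one comparison holds, so the two indicators never overlap.\<close>
    have "R y x \<longleftrightarrow> \<not> R x y" using "3.prems"[of x y] assms(2)[of x y] by auto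
    then show ?thesis unfolding of_bool_conj[symmetric] x y by (cases "R x y") simp_all
  qed
  finally show ?case .
qed simp_all

lemma nc_mult_apply: "(f \<odot> g) w = (\<Sum>k\<le>length w. f (take k w) * g (drop k w))"
  unfolding nc_mult_def
  by (rule sum.reindex_bij_witness[of _ "\<lambda>k. (take k w, drop k w)" "\<lambda>(u, v). length u"]) auto

lemma set_composition_block:
  assumes "set_composition n \<Phi>" "B \<in> set \<Phi>"
  shows "B \<noteq> {}" "B \<subseteq> {1..n}" "finite B" "Min B \<in> B"
proof -
  show "B \<noteq> {}" "B \<subseteq> {1..n}" using assms by (auto simp: set_composition_def)
  then show "finite B" using finite_subset by blast
  then show "Min B \<in> B" using \<open>B \<noteq> {}\<close> by (rule Min_in)
qed

lemma shift_conv_image: "\<Psi> \<up> n = map ((`) (\<lambda>x. x + n)) \<Psi>"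
  by (simp add: shift_def)

lemma Union_shift:
  assumes "set_composition m \<Psi>"
  shows "\<Union>(set (\<Psi> \<up> n)) = {n + 1..n + m}"
proof -
  have "\<Union>(set (\<Psi> \<up> n)) = (\<lambda>x. x + n) ` \<Union>(set \<Psi>)" by (auto simp: shift_def)
  also have "\<Union>(set \<Psi>) = {1..m}" using assms unfolding set_composition_iff by blast
  finally show ?thesis by (simp add: add.commute)
qed

text \<open>The two families of blocks cover the adjacent intervals \<open>{1..n}\<close> and
  \<open>{n + 1..n + m}\<close>.\<close>

lemma set_composition_shuffle:
  assumes \<Phi>: "set_composition n \<Phi>" and \<Psi>: "set_composition m \<Psi>" and \<Gamma>: "\<Gamma> \<in># shuffle \<Phi> (\<Psi> \<up> n)"
  shows "set_composition (n + m) \<Gamma>"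
  unfolding set_composition_iff
proof (intro conjI)
  note \<Phi>' = \<Phi>[unfolded set_composition_iff] and \<Psi>' = \<Psi>[unfolded set_composition_iff]
  have \<Gamma>: "\<Gamma> \<in> shuffles \<Phi> (\<Psi> \<up> n)" using \<Gamma> by (simp add: set_mset_shuffle)
  have set: "set \<Gamma> = set \<Phi> \<union> set (\<Psi> \<up> n)" using set_shuffles[OF \<Gamma>] .
  have inj: "inj_on ((`) (\<lambda>x. x + n)) UNIV" by (intro inj_on_image) (auto simp: inj_def)
  show "{} \<notin> set \<Gamma>" using \<Phi>' \<Psi>' by (auto simp: set shift_def)
  have dis: "A \<inter> B = {}" if "A \<in> set \<Phi>" "B \<in> set (\<Psi> \<up> n)" for A B
  proof -
    have "A \<subseteq> {1..n}" "B \<subseteq> {n + 1..n + m}"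
      using that \<Phi>' Union_shift[OF \<Psi>, of n] by blast+
    then show ?thesis by fastforce
  qed
  show "distinct \<Gamma>"
  proof (rule distinct_disjoint_shuffles[OF _ _ _ \<Gamma>])
    show "distinct (\<Psi> \<up> n)"
      using \<Psi>' inj by (auto simp: shift_conv_image distinct_map intro: inj_on_subset)
    \<comment> \<open>A common block would be disjoint from itself, hence empty, which
      \<open>\<Phi>'\<close> forbids.\<close>
    show "set \<Phi> \<inter> set (\<Psi> \<up> n) = {}" using dis[of A A for A] \<Phi>' by (metis disjoint_iff inf.idem)
  qed (use \<Phi>' in blast)
  have U: "\<Union>(set \<Phi>) = {1..n}" using \<Phi>' by blast
  have "disjoint (set (\<Psi> \<up> n))"
    unfolding disjoint_def
  proof (intro ballI impI)
    fix A B assume "A \<in> set (\<Psi> \<up> n)" "B \<in> set (\<Psi> \<up> n)" "A \<noteq> B"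
    then obtain A' B' where "A' \<in> set \<Psi>" "B' \<in> set \<Psi>" "A' \<noteq> B'"
      and AB: "A = (\<lambda>x. x + n) ` A'" "B = (\<lambda>x. x + n) ` B'" by (auto simp: shift_def)
    then have "A' \<inter> B' = {}" using \<Psi>' unfolding disjoint_def by blast
    then show "A \<inter> B = {}" using AB by auto
  qed
  moreover have "\<Union>(set \<Phi>) \<inter> \<Union>(set (\<Psi> \<up> n)) = {}"
    unfolding U Union_shift[OF \<Psi>] by auto
  ultimately show "disjoint (set \<Gamma>)"
    unfolding set using \<Phi>' by (intro disjoint_union) blast+
  show "\<Union>(set \<Gamma>) = {1..n + m}"
    unfolding set Union_Un_distrib U Union_shift[OF \<Psi>] by auto
qed

lemma letter_take:
  assumes "set_composition n \<Phi>" "B \<in> set \<Phi>"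
  shows "letter (take n w) B = letter w B"
proof -
  have "Min B \<in> {1..n}" using set_composition_block[OF assms] by blast
  then show ?thesis by (auto simp: letter_def)
qed

lemma letter_shift:
  assumes "set_composition m \<Psi>" "B \<in> set \<Psi>" "n \<le> length w"
  shows "letter w ((\<lambda>x. x + n) ` B) = letter (drop n w) B"
proof -
  note B = set_composition_block[OF assms(1,2)]
  have "Min ((\<lambda>x. x + n) ` B) = Min B + n"
    using B by (intro Min_image_strict_mono) (auto simp: strict_mono_on_def)
  \<comment> \<open>This makes the truncated subtraction exact:
    \<open>Min B + n - 1 = n + (Min B - 1)\<close>.\<close>
  moreover have "Min B \<ge> 1" using B by auto
  ultimately show ?thesis using assms(3) by (simp add: letter_def add.commute)
qed

lemma P_nc_mult_P:
  assumes \<Phi>: "set_composition n \<Phi>" and \<Psi>: "set_composition m \<Psi>"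
  shows "(P \<Phi> :: 'a::comm_ring_1 ncseries) \<odot> P \<Psi> = (\<Sum>\<Gamma> \<in># shuffle \<Phi> (\<Psi> \<up> n). P \<Gamma>)"
proof
  fix w
  let ?S = "shuffle \<Phi> (\<Psi> \<up> n)"
  \<comment> \<open>All shuffles have the same blocks, so the length and constancy conditions are a
    common factor and only sortedness varies.\<close>
  have term_eq: "(P \<Gamma> :: 'a ncseries) w = of_bool (length w = n + m \<and> constant_on_blocks w \<Phi> \<and>
      constant_on_blocks w (\<Psi> \<up> n)) * of_bool (sorted_wrt (precedes w) \<Gamma>)" if "\<Gamma> \<in># ?S" for \<Gamma>
  proof -
    have "set \<Gamma> = set \<Phi> \<union> set (\<Psi> \<up> n)" using that by (intro set_shuffles) (simp add: set_mset_shuffle)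
    then show ?thesis
      unfolding P_apply[OF set_composition_shuffle[OF \<Phi> \<Psi> that]]
      by (auto simp: constant_on_blocks_def)
  qed
  have total: "precedes w A B \<or> precedes w B A" if A: "A \<in> set \<Phi>" and B: "B \<in> set (\<Psi> \<up> n)" for A B
  proof -
    obtain B' where B': "B' \<in> set \<Psi>" "B = (\<lambda>x. x + n) ` B'" using B by (auto simp: shift_def)
    have "A \<inter> B = {}"
      using set_composition_block(2)[OF \<Phi> A] set_composition_block(2)[OF \<Psi> B'(1)] B' by fastforce
    then have "A >\<^sub>D B \<or> B >\<^sub>D A"
      using set_composition_block[OF \<Phi> A] set_composition_block[OF \<Psi> B'(1)] B'(2)
      by (intro D_greater_total) auto
    then show ?thesis by (auto simp: precedes_def)
  qed
  have "(\<Sum>\<Gamma> \<in># ?S. P \<Gamma> :: 'a ncseries) w = (\<Sum>\<Gamma> \<in># ?S. of_bool (length w = n + m \<and> constant_on_blocks w \<Phi> \<and>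
      constant_on_blocks w (\<Psi> \<up> n)) * of_bool (sorted_wrt (precedes w) \<Gamma>))"
    unfolding sum_mset_fun_apply
    by (intro arg_cong[of _ _ sum_mset] image_mset_cong term_eq)
  also have "\<dots> = of_bool (length w = n + m \<and> constant_on_blocks w \<Phi> \<and> constant_on_blocks w (\<Psi> \<up> n)) *
      of_bool (sorted_wrt (precedes w) \<Phi> \<and> sorted_wrt (precedes w) (\<Psi> \<up> n))"
    unfolding sum_mset_distrib_left[symmetric]
    by (subst sum_shuffle_sorted_wrt[OF precedes_trans]) (use total precedes_asym in auto)
  also have "\<dots> = ((P \<Phi> :: 'a ncseries) \<odot> P \<Psi>) w"
  proof (cases "length w = n + m")
    case True
    \<comment> \<open>\<open>P \<Phi>\<close> vanishes at words of length other than
      \<open>n\<close>, which leaves only the cut after \<open>n\<close> letters.\<close>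
    have "((P \<Phi> :: 'a ncseries) \<odot> P \<Psi>) w = (\<Sum>k\<in>{n}. P \<Phi> (take k w) * P \<Psi> (drop k w))"
      unfolding nc_mult_apply using True
      by (intro sum.mono_neutral_right) (auto simp: P_apply[OF \<Phi>])
    also have "\<dots> = P \<Phi> (take n w) * P \<Psi> (drop n w)" by simp
    also have "\<dots> = of_bool (constant_on_blocks (take n w) \<Phi> \<and> sorted_wrt (precedes (take n w)) \<Phi>) *
        of_bool (constant_on_blocks (drop n w) \<Psi> \<and> sorted_wrt (precedes (drop n w)) \<Psi>)"
      using True by (simp add: P_apply[OF \<Phi>] P_apply[OF \<Psi>])
    also have "constant_on_blocks (take n w) \<Phi> \<longleftrightarrow> constant_on_blocks w \<Phi>"
      unfolding constant_on_blocks_def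
    proof (intro ball_cong refl)
      fix B x assume B: "B \<in> set \<Phi>" "x \<in> B"
      then have "x \<in> {1..n}" using set_composition_block(2)[OF \<Phi>] by blast
      then show "take n w ! (x - 1) = letter (take n w) B \<longleftrightarrow> w ! (x - 1) = letter w B"
        unfolding letter_take[OF \<Phi> B(1)] by auto
    qed
    also have "sorted_wrt (precedes (take n w)) \<Phi> \<longleftrightarrow> sorted_wrt (precedes w) \<Phi>"
      unfolding sorted_wrt_iff_nth_Suc_transp[OF precedes_trans]
      by (simp add: precedes_def letter_take[OF \<Phi>])
    also have "constant_on_blocks (drop n w) \<Psi> \<longleftrightarrow> constant_on_blocks w (\<Psi> \<up> n)"
      unfolding constant_on_blocks_def shift_conv_image set_map ball_simps
    proof (intro ball_cong refl)
      fix B x assume B: "B \<in> set \<Psi>" "x \<in> B"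
      then have "x \<in> {1..m}" using set_composition_block(2)[OF \<Psi>] by blast
      then show "drop n w ! (x - 1) = letter (drop n w) B \<longleftrightarrow>
          w ! (x + n - 1) = letter w ((\<lambda>x. x + n) ` B)"
        using letter_shift[OF \<Psi> B(1), of n w] True by (simp add: add.commute)
    qed
    also have "sorted_wrt (precedes (drop n w)) \<Psi> \<longleftrightarrow> sorted_wrt (precedes w) (\<Psi> \<up> n)"
      unfolding shift_conv_image sorted_wrt_map
    \<comment> \<open>The equivalence is reduced to single pairs of blocks, whose letters and
      \<open>>\<^sub>D\<close> comparison survive the shift.\<close>
    proof (rule iffI; erule sorted_wrt_mono_rel[rotated])
      fix A B assume AB: "A \<in> set \<Psi>" "B \<in> set \<Psi>"
      note b = set_composition_block[OF \<Psi> AB(1)] set_composition_block[OF \<Psi> AB(2)]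
      have "(\<lambda>x. x + n) ` A >\<^sub>D (\<lambda>x. x + n) ` B \<longleftrightarrow> A >\<^sub>D B"
        using b by (intro D_greater_image_iff[of UNIV]) (auto simp: strict_mono_on_def)
      then have "precedes (drop n w) A B \<longleftrightarrow> precedes w ((\<lambda>x. x + n) ` A) ((\<lambda>x. x + n) ` B)"
        using AB letter_shift[OF \<Psi>, of _ n w] True by (simp add: precedes_def)
      then show "precedes (drop n w) A B \<Longrightarrow> precedes w ((\<lambda>x. x + n) ` A) ((\<lambda>x. x + n) ` B)"
        and "precedes w ((\<lambda>x. x + n) ` A) ((\<lambda>x. x + n) ` B) \<Longrightarrow> precedes (drop n w) A B" by blast+
    qed
    finally show ?thesis using True by simp
  next
    case False
    \<comment> \<open>No cut produces the lengths \<open>n\<close> and \<open>m\<close> together, so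
      every term has a zero factor.\<close>
    then show ?thesis
      unfolding nc_mult_apply
      by (intro sum.neutral[symmetric, THEN trans[rotated]]) (auto simp: P_apply[OF \<Phi>] P_apply[OF \<Psi>])
  qed
  finally show "((P \<Phi> :: 'a ncseries) \<odot> P \<Psi>) w = (\<Sum>\<Gamma> \<in># ?S. P \<Gamma>) w" by simp
qed

section \<open>Coproduct: cutting a filling after a column and juxtaposing fillings\<close>

section \<open>Coproducts\<close>

text \<open>The inserted \<open>0\<close> gives the empty filling no columns.\<close>

abbreviation columns :: "nat list \<Rightarrow> nat" where
  "columns c \<equiv> Max (insert 0 (set c))"

lemma length_col: "length (col \<Phi> c) = columns c"
  by (simp add: col_def del: Max_insert upt_Suc)

lemma LDD_sorted:
  assumes "c \<in> LDD \<Phi>"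
  shows "sorted c"
  unfolding sorted_iff_nth_Suc
proof (intro allI impI)
  fix i assume "Suc i < length c"
  then have "c ! Suc i = c ! i \<or> c ! Suc i = Suc (c ! i)" using assms by (auto simp: LDD_def)
  then show "c ! i \<le> c ! Suc i" by linarith
qed

lemma LDD_columns_last:
  assumes "c \<in> LDD \<Phi>" "c \<noteq> []"
  shows "columns c = last c"
proof (rule Max_eqI)
  have "sorted (butlast c @ [last c])" using LDD_sorted[OF assms(1)] assms(2) by simp
  then have "\<forall>x \<in> set (butlast c @ [last c]). x \<le> last c" by (auto simp: sorted_append)
  then show "x \<le> last c" if "x \<in> insert 0 (set c)" for x using that assms(2) by auto
qed (use assms(2) in auto)

lemma LDD_pos:
  assumes "c \<in> LDD \<Phi>" "x \<in> set c"
  shows "0 < x"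
proof -
  \<comment> \<open>\<open>LDD_columns\<close> has \<open>set c\<close> on both sides, so it is
    substituted once instead of serving as a rewrite rule.\<close>
  have "x \<in> {1..columns c}" using assms(2) LDD_columns[OF assms(1)] by (rule subst[rotated])
  then show ?thesis by simp
qed

text \<open>Column numbers of a filling start at 1, so the offset puts \<open>d\<close> directly to
  the right of the last column of \<open>c\<close>.\<close>

definition join :: "nat list \<Rightarrow> nat list \<Rightarrow> nat list" where
  "join c d = c @ map (\<lambda>x. columns c + x) d"

lemma columns_join: "columns (join c d) = columns c + columns d"
proof (rule Max_eqI)
  show "y \<le> columns c + columns d" if "y \<in> insert 0 (set (join c d))" for y
    using that by (auto simp: join_def simp del: Max_insert intro: trans_le_add1)
  have "columns d \<in> insert 0 (set d)" "columns c \<in> insert 0 (set c)" by (rule Max_in; simp)+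
  then show "columns c + columns d \<in> insert 0 (set (join c d))"
    by (auto simp: join_def simp del: Max_insert)
qed simp

text \<open>Steps inside each part are unchanged; at the seam a new column begins, which
  \<open>LDD\<close> allows for any two blocks.\<close>

lemma join_in_LDD:
  assumes c: "c \<in> LDD \<Phi>" and d: "d \<in> LDD \<Psi>"
  shows "join c d \<in> LDD (\<Phi> @ \<Psi>)"
  unfolding LDD_def
proof (intro CollectI conjI impI allI)
  have len: "length c = length \<Phi>" "length d = length \<Psi>" using c d by (simp_all add: LDD_def)
  then show "length (join c d) = length (\<Phi> @ \<Psi>)" by (simp add: join_def)
  have c0: "c \<noteq> [] \<Longrightarrow> c ! 0 = 1" and d0: "d \<noteq> [] \<Longrightarrow> d ! 0 = 1"
    using c d by (simp_all add: LDD_def)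
  show "join c d ! 0 = 1" if "join c d \<noteq> []"
    using that c0 d0 by (cases "c = []") (auto simp: join_def nth_append)
  fix i assume i: "Suc i < length (\<Phi> @ \<Psi>)"
  consider "Suc i < length c" | "Suc i = length c" | k where "i = length c + k"
    by (metis le_add_diff_inverse less_Suc_eq_le linorder_cases)
  then show "(join c d ! Suc i = join c d ! i \<and> (\<Phi> @ \<Psi>) ! i >\<^sub>D (\<Phi> @ \<Psi>) ! Suc i) \<or>
      join c d ! Suc i = Suc (join c d ! i)"
  proof cases
    case 1
    then have "(c ! Suc i = c ! i \<and> \<Phi> ! i >\<^sub>D \<Phi> ! Suc i) \<or> c ! Suc i = Suc (c ! i)"
      using c len unfolding LDD_def by simp
    then show ?thesis using 1 len by (simp add: join_def nth_append)
  next
    case 2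
    \<comment> \<open>The seam: \<open>c\<close> ends in its last column and \<open>d\<close> starts
      in column 1, so the number grows by one.\<close>
    then have "c \<noteq> []" "d \<noteq> []" using i len by auto
    moreover have "i = length c - 1" using 2 by simp
    ultimately have "join c d ! Suc i = columns c + 1" "join c d ! i = last c"
      using 2 d0 by (simp_all add: join_def nth_append last_conv_nth del: Max_insert)
    then show ?thesis using LDD_columns_last[OF c \<open>c \<noteq> []\<close>] by simp
  next
    case 3
    then have "Suc k < length \<Psi>" using i len by simp
    then have "(d ! Suc k = d ! k \<and> \<Psi> ! k >\<^sub>D \<Psi> ! Suc k) \<or> d ! Suc k = Suc (d ! k)"
      using d unfolding LDD_def by blast
    then show ?thesis using 3 \<open>Suc k < length \<Psi>\<close> len by (simp add: join_def nth_append del: Max_insert)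
  qed
qed

text \<open>The offset separates the column numbers: those up to \<open>columns c\<close> see only
  blocks of \<open>\<Phi>\<close>, the later ones only blocks of \<open>\<Psi>\<close>.\<close>

lemma col_join:
  assumes c: "c \<in> LDD \<Phi>" and d: "d \<in> LDD \<Psi>"
  shows "col (\<Phi> @ \<Psi>) (join c d) = col \<Phi> c @ col \<Psi> d"
proof -
  have len: "length c = length \<Phi>" "length d = length \<Psi>" using c d by (simp_all add: LDD_def)
  let ?U = "\<lambda>z j. \<Union>{B. (B, j) \<in> set z}"
  let ?z = "zip (\<Phi> @ \<Psi>) (join c d)"
  have z: "set ?z = set (zip \<Phi> c) \<union> (\<lambda>(B, x). (B, columns c + x)) ` set (zip \<Psi> d)"
    using len by (simp add: join_def zip_map2 del: Max_insert)
  have upt: "[1..<Suc (columns c + columns d)] = [1..<Suc (columns c)] @ map (\<lambda>x. columns c + x) [1..<Suc (columns d)]"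
    by (rule nth_equalityI) (auto simp: nth_append simp del: upt_Suc Max_insert)
  have "map (?U ?z) [1..<Suc (columns c)] = map (?U (zip \<Phi> c)) [1..<Suc (columns c)]"
  proof (intro map_cong refl)
    fix j assume "j \<in> set [1..<Suc (columns c)]"
    then have "(B, j) \<notin> (\<lambda>(B, x). (B, columns c + x)) ` set (zip \<Psi> d)" for B
      using LDD_pos[OF d] by (force dest: set_zip_rightD simp del: Max_insert)
    then show "?U ?z j = ?U (zip \<Phi> c) j" unfolding z by blast
  qed
  moreover have "map (?U ?z) (map (\<lambda>x. columns c + x) [1..<Suc (columns d)]) =
      map (?U (zip \<Psi> d)) [1..<Suc (columns d)]"
    unfolding map_map
  proof (intro map_cong refl)
    fix j assume j: "j \<in> set [1..<Suc (columns d)]"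
    have "(B, columns c + j) \<notin> set (zip \<Phi> c)" for B
    proof
      assume "(B, columns c + j) \<in> set (zip \<Phi> c)"
      then have "columns c + j \<in> insert 0 (set c)" by (metis insertI2 set_zip_rightD)
      then have "columns c + j \<le> columns c" by (intro Max_ge) simp_all
      then show False using j by (simp del: Max_insert upt_Suc)
    qed
    then have "{B. (B, columns c + j) \<in> set ?z} = {B. (B, j) \<in> set (zip \<Psi> d)}"
      unfolding z by auto
    then show "(?U ?z \<circ> (\<lambda>x. columns c + x)) j = ?U (zip \<Psi> d) j" by simp
  qed
  moreover have "length (join c d) = length (\<Phi> @ \<Psi>)" using len by (simp add: join_def)
  ultimately show ?thesis
    by (simp only: col_conv_zip len columns_join upt map_append)
qed

text \<open>Column numbers are sorted, so the blocks in the first \<open>i\<close> columns form an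
  initial segment; subtracting \<open>i\<close> renumbers the other columns from 1. The bound on
  \<open>i\<close> ensures that the left part really has \<open>i\<close> columns.\<close>

lemma LDD_split:
  assumes c: "c \<in> LDD \<Phi>" and i: "i \<le> columns c"
  defines "d \<equiv> takeWhile (\<lambda>x. x \<le> i) c" and "e \<equiv> map (\<lambda>x. x - i) (dropWhile (\<lambda>x. x \<le> i) c)"
  shows "d \<in> LDD (take (length d) \<Phi>)" "e \<in> LDD (drop (length d) \<Phi>)"
    and "columns d = i" "join d e = c"
proof -
  define j where "j = length d"
  have len: "length c = length \<Phi>" using c by (simp add: LDD_def)
  have c0: "c \<noteq> [] \<Longrightarrow> c ! 0 = 1" using c by (simp add: LDD_def)
  have step: "(c ! Suc k = c ! k \<and> \<Phi> ! k >\<^sub>D \<Phi> ! Suc k) \<or> c ! Suc k = Suc (c ! k)"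
    if "Suc k < length c" for k using c that unfolding LDD_def by simp
  have d: "d = take j c" unfolding d_def j_def by (rule takeWhile_eq_take)
  have e: "e = map (\<lambda>x. x - i) (drop j c)"
    unfolding e_def j_def d_def by (simp only: dropWhile_eq_drop)
  have j: "j \<le> length c" unfolding j_def d_def by (rule length_takeWhile_le)
  show dL: "d \<in> LDD (take (length d) \<Phi>)"
    unfolding j_def[symmetric] unfolding d LDD_def using len j c0 step by auto
  have gt: "i < c ! k" if "j \<le> k" "k < length c" for k
  proof -
    have "\<not> c ! j \<le> i"
      unfolding j_def d_def using that by (intro nth_length_takeWhile) (auto simp: j_def d_def)
    then show ?thesis using sorted_nth_mono[OF LDD_sorted[OF c] that] by simp
  qed
  have le: "c ! k \<le> i" if "k < j" for k
  proof -
    have "c ! k = d ! k" using that by (simp add: d)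
    also have "\<dots> \<in> set d" using that by (simp add: j_def)
    finally show ?thesis unfolding d_def by (auto dest: set_takeWhileD)
  qed
  \<comment> \<open>Column numbers start at 1 and rise by at most one, so the first entry beyond
    \<open>i\<close> is exactly \<open>Suc i\<close>.\<close>
  have first: "c ! j = Suc i" if "j < length c"
  proof (cases j)
    case 0
    then show ?thesis using gt[of 0] c0 that by force
  next
    case (Suc k)
    then show ?thesis using gt[of j] le[of k] step[of k] that by auto
  qed
  show "e \<in> LDD (drop (length d) \<Phi>)"
    unfolding j_def[symmetric] unfolding e LDD_def
  proof (intro CollectI conjI impI allI)
    show "map (\<lambda>x. x - i) (drop j c) ! 0 = 1" if "map (\<lambda>x. x - i) (drop j c) \<noteq> []"
      using that first by simp
    fix k assume k: "Suc k < length (drop j \<Phi>)"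
    then have "Suc (j + k) < length c" using len by simp
    \<comment> \<open>All entries here exceed \<open>i\<close>, so the truncated subtraction
      preserves equality and steps of one.\<close>
    then show "(map (\<lambda>x. x - i) (drop j c) ! Suc k = map (\<lambda>x. x - i) (drop j c) ! k \<and>
        drop j \<Phi> ! k >\<^sub>D drop j \<Phi> ! Suc k) \<or>
        map (\<lambda>x. x - i) (drop j c) ! Suc k = Suc (map (\<lambda>x. x - i) (drop j c) ! k)"
      using step[of "j + k"] gt[of "j + k"] len by (auto simp: Suc_diff_le)
  qed (simp add: len)
  show cd: "columns d = i"
  proof (cases "d = []")
    case True
    then have "j = 0" by (simp add: j_def)
    then have "i = 0" using first c0 i by (cases "c = []") auto
    then show ?thesis using True by simp
  next
    case False
    then have "0 < j" by (simp add: j_def)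
    then have last: "last d = c ! (j - 1)" using False j by (simp add: d last_conv_nth)
    have "c ! (j - 1) = i"
    \<comment> \<open>If entries remain, \<open>c\<close> steps at the cut from \<open>i\<close> to
      \<open>Suc i\<close>; otherwise the last entry is \<open>columns c\<close>, which is at least
      \<open>i\<close>.\<close>
    proof (cases "j < length c")
      case True
      then show ?thesis using first step[of "j - 1"] le[of "j - 1"] \<open>0 < j\<close> by auto
    next
      case False
      then have "j = length c" using j by simp
      moreover have "c \<noteq> []" using calculation \<open>0 < j\<close> by auto
      ultimately have "c ! (j - 1) = columns c"
        using LDD_columns_last[OF c] by (simp add: last_conv_nth)
      moreover have "c ! (j - 1) \<le> i" using le[of "j - 1"] \<open>0 < j\<close> by simp
      ultimately show ?thesis using i by linarith
    qed
    then show ?thesis using LDD_columns_last[OF dL \<open>d \<noteq> []\<close>] last by simp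
  qed
  have "map (\<lambda>x. i + (x - i)) (drop j c) = drop j c"
  proof (rule map_idI)
    fix x assume "x \<in> set (drop j c)"
    then obtain k where k: "k < length c - j" "x = c ! (j + k)" by (auto simp: in_set_conv_nth)
    then have "j + k < length c" by linarith
    then show "i + (x - i) = x" using gt[of "j + k"] k by simp
  qed
  then show "join d e = c"
    unfolding join_def cd by (simp add: d e comp_def)
qed

text \<open>Entries of \<open>c\<close> are at most \<open>columns c\<close>, and the shifted
  entries of \<open>d\<close> exceed it because those of \<open>d\<close> are positive.\<close>

lemma split_join:
  assumes c: "c \<in> LDD \<Phi>" and d: "d \<in> LDD \<Psi>"
  shows "takeWhile (\<lambda>x. x \<le> columns c) (join c d) = c"
    and "map (\<lambda>x. x - columns c) (dropWhile (\<lambda>x. x \<le> columns c) (join c d)) = d"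
proof -
  have le: "x \<le> columns c" if "x \<in> set c" for x using that by (intro Max_ge) simp_all
  have "takeWhile (\<lambda>x. x \<le> columns c) (map (\<lambda>x. columns c + x) d) = []"
    "dropWhile (\<lambda>x. x \<le> columns c) (map (\<lambda>x. columns c + x) d) = map (\<lambda>x. columns c + x) d"
    unfolding takeWhile_eq_Nil_iff dropWhile_eq_self_iff
    using LDD_pos[OF d hd_in_set] by (auto simp: hd_map simp del: Max_insert)
  then show "takeWhile (\<lambda>x. x \<le> columns c) (join c d) = c"
    "map (\<lambda>x. x - columns c) (dropWhile (\<lambda>x. x \<le> columns c) (join c d)) = d"
    unfolding join_def using le
    by (simp_all add: comp_def del: Max_insert)
qed

section \<open>Standardization and assembly of the coproduct formula\<close>

lemma st_conv_image: "st \<Phi> = map ((`) (\<lambda>x. card {y \<in> \<Union>(set \<Phi>). y \<le> x})) \<Phi>"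
  by (simp add: st_def)

text \<open>Counting the elements up to \<open>x\<close> is strictly increasing on the underlying
  set, and fillings depend only on comparisons that such a relabelling preserves.\<close>

lemma LDD_st:
  assumes "\<And>B. B \<in> set \<Phi> \<Longrightarrow> finite B \<and> B \<noteq> {}"
  shows "LDD (st \<Phi>) = LDD \<Phi>"
  unfolding st_conv_image
proof (rule LDD_map_image)
  show "strict_mono_on (\<Union>(set \<Phi>)) (\<lambda>x. card {y \<in> \<Union>(set \<Phi>). y \<le> x})"
  proof (rule strict_mono_onI, rule psubset_card_mono)
    fix a b assume "a \<in> \<Union>(set \<Phi>)" "b \<in> \<Union>(set \<Phi>)" "a < b"
    then have "b \<in> {y \<in> \<Union>(set \<Phi>). y \<le> b}" by blast
    moreover have "b \<notin> {y \<in> \<Union>(set \<Phi>). y \<le> a}" using \<open>a < b\<close> by simp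
    moreover have "{y \<in> \<Union>(set \<Phi>). y \<le> a} \<subseteq> {y \<in> \<Union>(set \<Phi>). y \<le> b}"
      using \<open>a < b\<close> by (intro Collect_mono) simp
    ultimately show "{y \<in> \<Union>(set \<Phi>). y \<le> a} \<subset> {y \<in> \<Union>(set \<Phi>). y \<le> b}"
      by (metis psubsetI)
  qed (use assms in auto)
qed (use assms in auto)

text \<open>By \<open>Union_col\<close> the blocks and the columns have the same underlying set, so
  one relabelling standardizes both.\<close>

lemma col_st:
  assumes "c \<in> LDD \<Phi>"
  shows "col (st \<Phi>) c = st (col \<Phi> c)"
  unfolding st_conv_image Union_col[OF assms] col_map_image ..

text \<open>\<open>coproduct_add\<close> is stated for members of \<open>NCQSym\<close>, so the
  induction also places the partial sums in the span.\<close>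

lemma coproduct_sum_M:
  assumes "finite I" "\<And>i. i \<in> I \<Longrightarrow> set_composition n (\<phi> i)"
  shows "\<Delta> (\<Sum>i\<in>I. M (\<phi> i) :: 'a::comm_ring_1 ncseries) = (\<Sum>i\<in>I. \<Delta> (M (\<phi> i)))"
  using assms
proof (induction I)
  case empty
  then show ?case by (simp add: coproduct_def M_coeff_def zero_fun_def)
next
  case (insert i I)
  have M: "(M (\<phi> k) :: 'a ncseries) \<in> NCQSym" if "k \<in> insert i I" for k
    unfolding NCQSym_def using insert.prems[OF that] by (intro scale.span_base) blast
  then have "(\<Sum>i\<in>I. M (\<phi> i) :: 'a ncseries) \<in> NCQSym"
    unfolding NCQSym_def by (intro scale.span_sum) simp
  moreover have "\<Delta> (\<Sum>i\<in>I. M (\<phi> i) :: 'a ncseries) = (\<Sum>i\<in>I. \<Delta> (M (\<phi> i)))"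
    using insert by blast
  ultimately show ?case
    using M[of i] by (simp only: sum.insert[OF insert.hyps] coproduct_add insertI1)
qed

lemma tensor_sum: "sum f A \<otimes> sum g B = (\<Sum>a\<in>A. \<Sum>b\<in>B. f a \<otimes> g b)"
  by (simp add: tensor_def fun_eq_iff sum_fun_apply sum_product)

lemma coproduct_P:
  assumes \<Phi>: "set_composition n \<Phi>"
  shows "\<Delta> (P \<Phi> :: 'a::comm_ring_1 ncseries) =
    (\<Sum>i=0..length \<Phi>. P (st (take i \<Phi>)) \<otimes> P (st (drop i \<Phi>)))"
proof -
  let ?f = "\<lambda>c i. M (st (take i (col \<Phi> c))) \<otimes> M (st (drop i (col \<Phi> c))) :: nat list \<times> nat list \<Rightarrow> 'a"
  let ?g = "\<lambda>j c d. M (col (st (take j \<Phi>)) c) \<otimes> M (col (st (drop j \<Phi>)) d) :: nat list \<times> nat list \<Rightarrow> 'a"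
  have blocks: "finite B \<and> B \<noteq> {}" if "B \<in> set \<Phi>" for B
    using set_composition_block[OF \<Phi> that] by simp
  have "\<Delta> (P \<Phi> :: 'a ncseries) = (\<Sum>c\<in>LDD \<Phi>. \<Delta> (M (col \<Phi> c)))"
    unfolding P_def using set_composition_col[OF \<Phi>] by (intro coproduct_sum_M finite_LDD)
  also have "\<dots> = (\<Sum>c\<in>LDD \<Phi>. \<Sum>i=0..columns c. ?f c i)"
    using coproduct_M[OF set_composition_col[OF \<Phi>], where 'a = 'a]
    by (intro sum.cong refl) (simp only: length_col)
  also have "\<dots> = (\<Sum>(c, i)\<in>(SIGMA c:LDD \<Phi>. {0..columns c}). ?f c i)"
    by (intro sum.Sigma finite_LDD) simp
  also have "\<dots> = (\<Sum>(j, c, d)\<in>(SIGMA j:{0..length \<Phi>}. LDD (take j \<Phi>) \<times> LDD (drop j \<Phi>)). ?g j c d)"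
  \<comment> \<open>Cutting after column \<open>i\<close> and \<open>join\<close> are the two
    inverse maps. The cases: joining undoes cutting, cutting lands in the target, cutting undoes
    joining, joining lands in the source, the summands agree.\<close>
  proof (rule sum.reindex_bij_witness[of _
      "\<lambda>(j, c, d). (join c d, columns c)"
      "\<lambda>(c, i). (length (takeWhile (\<lambda>x. x \<le> i) c), takeWhile (\<lambda>x. x \<le> i) c,
        map (\<lambda>x. x - i) (dropWhile (\<lambda>x. x \<le> i) c))"], goal_cases)
    case (1 x)
    then show ?case by (auto simp: LDD_split(3,4) simp del: Max_insert)
  next
    case (2 x)
    then obtain c i where x: "x = (c, i)" "c \<in> LDD \<Phi>" "i \<le> columns c" by auto
    have "length (takeWhile (\<lambda>x. x \<le> i) c) \<le> length \<Phi>"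
      using x(2) length_takeWhile_le[of "\<lambda>x. x \<le> i" c] by (simp add: LDD_def)
    then show ?case using LDD_split(1,2)[OF x(2,3)] by (simp add: x(1))
  next
    case (3 x)
    then obtain j c d where x: "x = (j, c, d)" "c \<in> LDD (take j \<Phi>)" "d \<in> LDD (drop j \<Phi>)" "j \<le> length \<Phi>"
      by auto
    \<comment> \<open>\<open>j \<le> length \<Phi>\<close> gives \<open>take j \<Phi>\<close>
      exactly \<open>j\<close> blocks, so \<open>j\<close> is recovered from the left
      filling.\<close>
    then have "length c = j" by (simp add: LDD_def)
    then show ?case by (simp only: x(1) prod.case split_join[OF x(2,3)])
  next
    case (4 x)
    then obtain j c d where x: "x = (j, c, d)" "c \<in> LDD (take j \<Phi>)" "d \<in> LDD (drop j \<Phi>)" by auto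
    then show ?case
      using join_in_LDD[OF x(2,3)] columns_join[of c d] by (simp del: Max_insert)
  next
    case (5 x)
    then obtain c i where x: "x = (c, i)" "c \<in> LDD \<Phi>" "i \<le> columns c" by auto
    let ?d = "takeWhile (\<lambda>x. x \<le> i) c" and ?e = "map (\<lambda>x. x - i) (dropWhile (\<lambda>x. x \<le> i) c)"
    let ?j = "length ?d"
    note split = LDD_split[OF x(2,3)]
    have "col \<Phi> c = col (take ?j \<Phi>) ?d @ col (drop ?j \<Phi>) ?e"
      using col_join[OF split(1,2)] unfolding split(4) append_take_drop_id .
    \<comment> \<open>So \<open>take i\<close> and \<open>drop i\<close> of
      \<open>col \<Phi> c\<close> are the columns of the two parts, and \<open>col_st\<close> moves
      \<open>st\<close> onto the blocks.\<close>
    moreover have "length (col (take ?j \<Phi>) ?d) = i"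
      unfolding length_col split(3) ..
    ultimately have "?g ?j ?d ?e = ?f c i"
      using col_st[OF split(1)] col_st[OF split(2)] by simp
    then show ?case by (simp only: x(1) prod.case)
  qed
  also have "\<dots> = (\<Sum>j=0..length \<Phi>. \<Sum>(c, d)\<in>LDD (take j \<Phi>) \<times> LDD (drop j \<Phi>). ?g j c d)"
    by (subst sum.Sigma) (auto simp: finite_LDD)
  also have "\<dots> = (\<Sum>j=0..length \<Phi>. P (st (take j \<Phi>)) \<otimes> P (st (drop j \<Phi>)))"
  proof (intro sum.cong refl)
    fix j
    \<comment> \<open>The sums thus run over the fillings that define \<open>P\<close> of the
      standardized parts.\<close>
    have "LDD (st (take j \<Phi>)) = LDD (take j \<Phi>)" "LDD (st (drop j \<Phi>)) = LDD (drop j \<Phi>)"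
      using blocks by (auto intro!: LDD_st dest: in_set_takeD in_set_dropD)
    then show "(\<Sum>(c, d)\<in>LDD (take j \<Phi>) \<times> LDD (drop j \<Phi>). ?g j c d) =
        P (st (take j \<Phi>)) \<otimes> P (st (drop j \<Phi>))"
      by (simp add: P_def tensor_sum sum.cartesian_product)
  qed
  finally show ?thesis .
qed

theorem theorem4p6:
  fixes \<Phi> \<Psi> :: "nat set list" and n m :: nat
  assumes "set_composition n \<Phi>" and "set_composition m \<Psi>"
  shows "(P \<Phi> :: 'a::comm_ring_1 ncseries) \<odot> P \<Psi> = (\<Sum>\<Gamma> \<in># shuffle \<Phi> (\<Psi> \<up> n). P \<Gamma>) \<and>
         \<Delta> (P \<Phi> :: 'a ncseries) =
           (\<Sum>i=0..length \<Phi>. P (st (take i \<Phi>)) \<otimes> P (st (drop i \<Phi>)))"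
  using P_nc_mult_P[OF assms] coproduct_P[OF assms(1)] by blast

end
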